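(* Let $g \geq 2$, let $\Sigma_g$ be a closed oriented surface of genus $g$, and let $$\pi = \pi_1(\Sigma_g) = \langle a_1,b_1,\ldots,a_g,b_g \mid [a_1,b_1]\cdots[a_g,b_g] = 1\rangle$$ be its (nonabelian) fundamental group, with standard generating set $S = \{a_1,b_1,\ldots,a_g,b_g\}$. Then for all integers $k \geq 1$ we have $d_{\pi,S}(k) \geq \frac{1}{4}k$. That is, every nontrivial element $w \in \gamma_k(\pi)$ satisfies $\|w\|_S \geq \frac{1}{4}k$.
   Context: The commutator convention is $[x,y] = xyx^{-1}y^{-1}$. For a group $G$, the lower central series is $\gamma_1(G) = G$ and $\gamma_{k+1}(G) = [\gamma_k(G),G]$ for $k \geq 1$. For a group $G$ with finite generating set $S$ and $g \in G$, the word norm $\|g\|_S$ is the minimal $\ell$ such that $g$ can be written as a word of length $\ell$ in $S^{\pm 1}$. For a non-nilpotent residually nilpotent group $G$ (residually nilpotent means $\bigcap_{k \geq 1}\gamma_k(G) = 1$) with finite generating set $S$, the lower central series depth function is $d_{G,S}(k) = \min\{\|g\|_S \mid g \in \gamma_k(G),\ g \neq 1\}$. Nonabelian surface groups are residually nilpotent and not nilpotent. *)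

theory Defs
  imports "HOL-Algebra.Generated_Groups" "HOL.Real"
begin

section \<open>Lower central series, word norm and depth\<close>

definition commutator :: "('a, 'm) monoid_scheme \<Rightarrow> 'a \<Rightarrow> 'a \<Rightarrow> 'a" where
  "commutator G x y = x \<otimes>\<^bsub>G\<^esub> y \<otimes>\<^bsub>G\<^esub> inv\<^bsub>G\<^esub> x \<otimes>\<^bsub>G\<^esub> inv\<^bsub>G\<^esub> y"

definition commutator_subgroup :: "('a, 'm) monoid_scheme \<Rightarrow> 'a set \<Rightarrow> 'a set \<Rightarrow> 'a set" where
  "commutator_subgroup G H K = generate G {commutator G x y | x y. x \<in> H \<and> y \<in> K}"

text \<open>Indexing starts at 1; the value at 0 is a dummy.\<close>

fun lower_central :: "('a, 'm) monoid_scheme \<Rightarrow> nat \<Rightarrow> 'a set" where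
  "lower_central G 0 = carrier G"
| "lower_central G (Suc 0) = carrier G"
| "lower_central G (Suc (Suc k)) =
     commutator_subgroup G (lower_central G (Suc k)) (carrier G)"

text \<open>
  In the following two definitions the infimum is taken in \<^typ>\<open>nat\<close>. It is a minimum if the set
  is nonempty (that is, if \<open>h\<close> lies in the subgroup generated by \<open>S\<close>, respectively if the \<open>k\<close>-th
  term of the lower central series is nontrivial); otherwise its value is 0.
\<close>

definition word_norm :: "('a, 'm) monoid_scheme \<Rightarrow> 'a set \<Rightarrow> 'a \<Rightarrow> nat" where
  "word_norm G S h =
     Inf {length xs | xs. set xs \<subseteq> S \<union> m_inv G ` S \<and> foldr (\<otimes>\<^bsub>G\<^esub>) xs \<one>\<^bsub>G\<^esub> = h}"

definition lcs_depth :: "('a, 'm) monoid_scheme \<Rightarrow> 'a set \<Rightarrow> nat \<Rightarrow> nat" where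
  "lcs_depth G S k = Inf {word_norm G S h | h. h \<in> lower_central G k \<and> h \<noteq> \<one>\<^bsub>G\<^esub>}"


section \<open>Groups given by generators and relators\<close>

text \<open>
  A word over \<open>X\<close> is a list of signed letters: \<open>(x, True)\<close> stands for \<open>x\<close> and \<open>(x, False)\<close> for the
  formal inverse of \<open>x\<close>. The group presented by generators \<open>X\<close> and relators \<open>R\<close> consists of the
  words over \<open>X\<close> modulo insertion and deletion of relators and of pairs of inverse letters.
\<close>

type_synonym 'x word = "('x \<times> bool) list"

definition words :: "'x set \<Rightarrow> 'x word set" where
  "words X = lists (X \<times> UNIV)"

inductive pres_eq :: "'x set \<Rightarrow> 'x word set \<Rightarrow> 'x word \<Rightarrow> 'x word \<Rightarrow> bool"
  for X :: "'x set" and R :: "'x word set" where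
  refl: "u \<in> words X \<Longrightarrow> pres_eq X R u u"
| sym: "pres_eq X R u v \<Longrightarrow> pres_eq X R v u"
| trans: "pres_eq X R u v \<Longrightarrow> pres_eq X R v w \<Longrightarrow> pres_eq X R u w"
| cancel: "u \<in> words X \<Longrightarrow> v \<in> words X \<Longrightarrow> x \<in> X \<Longrightarrow>
    pres_eq X R (u @ [(x, b), (x, \<not> b)] @ v) (u @ v)"
| relator: "u \<in> words X \<Longrightarrow> v \<in> words X \<Longrightarrow> r \<in> R \<Longrightarrow> r \<in> words X \<Longrightarrow>
    pres_eq X R (u @ r @ v) (u @ v)"

definition word_class :: "'x set \<Rightarrow> 'x word set \<Rightarrow> 'x word \<Rightarrow> 'x word set" where
  "word_class X R u = {v. pres_eq X R u v}"

definition presented_group :: "'x set \<Rightarrow> 'x word set \<Rightarrow> 'x word set monoid" where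
  "presented_group X R =
     \<lparr>carrier = word_class X R ` words X,
      mult = (\<lambda>A B. \<Union>u\<in>A. \<Union>v\<in>B. word_class X R (u @ v)),
      one = word_class X R []\<rparr>"

lemma words_simps [simp]:
  "[] \<in> words X"
  "a # u \<in> words X \<longleftrightarrow> fst a \<in> X \<and> u \<in> words X"
  "u @ v \<in> words X \<longleftrightarrow> u \<in> words X \<and> v \<in> words X"
  by (cases a; auto simp: words_def)+

lemma pres_eq_words:
  assumes "pres_eq X R u v"
  shows "u \<in> words X \<and> v \<in> words X"
  using assms by induction auto

lemma pres_eq_context:
  assumes "pres_eq X R u v" "p \<in> words X" "q \<in> words X"
  shows "pres_eq X R (p @ u @ q) (p @ v @ q)"
  using assms
proof induction
  case (refl u)
  then show ?case by (simp add: pres_eq.refl)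
next
  case (sym u v)
  then show ?case by (blast intro: pres_eq.sym)
next
  case (trans u v w)
  then show ?case by (blast intro: pres_eq.trans)
next
  case (cancel u v x b)
  then show ?case using pres_eq.cancel[of "p @ u" X "v @ q" x R b] by simp
next
  case (relator u v r)
  then show ?case using pres_eq.relator[of "p @ u" X "v @ q" r R] by simp
qed

lemma pres_eq_append:
  assumes "pres_eq X R u u'" "pres_eq X R v v'"
  shows "pres_eq X R (u @ v) (u' @ v')"
proof -
  have "pres_eq X R (u @ v) (u' @ v)"
    using pres_eq_context[OF assms(1), of "[]" v] pres_eq_words[OF assms(2)] by simp
  moreover have "pres_eq X R (u' @ v) (u' @ v')"
    using pres_eq_context[OF assms(2), of u' "[]"] pres_eq_words[OF assms(1)] by simp
  ultimately show ?thesis by (rule pres_eq.trans)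
qed

lemma word_class_eq_iff:
  assumes "u \<in> words X"
  shows "word_class X R u = word_class X R v \<longleftrightarrow> pres_eq X R u v"
proof
  assume "word_class X R u = word_class X R v"
  then have "pres_eq X R v u"
    using pres_eq.refl[OF assms, of R] by (auto simp: word_class_def)
  then show "pres_eq X R u v" by (rule pres_eq.sym)
next
  assume uv: "pres_eq X R u v"
  have "pres_eq X R u w \<longleftrightarrow> pres_eq X R v w" for w
    using pres_eq.trans[OF uv, of w] pres_eq.trans[OF pres_eq.sym[OF uv], of w] by blast
  then show "word_class X R u = word_class X R v"
    by (simp add: word_class_def)
qed

lemma carrier_presented_group: "carrier (presented_group X R) = word_class X R ` words X"
  and one_presented_group: "\<one>\<^bsub>presented_group X R\<^esub> = word_class X R []"
  by (simp_all add: presented_group_def)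

lemma mult_presented_group:
  assumes "u \<in> words X" "v \<in> words X"
  shows "word_class X R u \<otimes>\<^bsub>presented_group X R\<^esub> word_class X R v = word_class X R (u @ v)"
proof -
  have *: "word_class X R (u' @ v') = word_class X R (u @ v)"
    if "u' \<in> word_class X R u" "v' \<in> word_class X R v" for u' v'
  proof -
    have "pres_eq X R (u @ v) (u' @ v')"
      using that by (auto simp: word_class_def intro: pres_eq_append)
    then show ?thesis using assms word_class_eq_iff[of "u @ v" X R "u' @ v'"] by simp
  qed
  have "(\<Union>u'\<in>word_class X R u. \<Union>v'\<in>word_class X R v. word_class X R (u' @ v')) =
      (\<Union>u'\<in>word_class X R u. \<Union>v'\<in>word_class X R v. word_class X R (u @ v))"
    by (intro SUP_cong HOL.refl *)
  moreover have "u \<in> word_class X R u" "v \<in> word_class X R v"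
    using assms by (simp_all add: word_class_def pres_eq.refl)
  ultimately show ?thesis by (auto simp: presented_group_def)
qed

definition word_inv :: "'x word \<Rightarrow> 'x word" where
  "word_inv u = rev (map (\<lambda>(x, b). (x, \<not> b)) u)"

lemma word_inv_words: "u \<in> words X \<Longrightarrow> word_inv u \<in> words X"
  by (auto simp: words_def word_inv_def)

lemma word_inv_left:
  assumes "u \<in> words X"
  shows "pres_eq X R (word_inv u @ u) []"
  using assms
proof (induction u)
  case Nil
  then show ?case by (simp add: word_inv_def pres_eq.refl)
next
  case (Cons a u)
  obtain x b where a: "a = (x, b)" by (cases a)
  have "pres_eq X R (word_inv u @ [(x, \<not> b), (x, \<not> \<not> b)] @ u) (word_inv u @ u)"
    using Cons.prems a by (intro pres_eq.cancel) (auto intro: word_inv_words)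
  then show ?case
    using Cons a pres_eq.trans[of X R "word_inv u @ [(x, \<not> b), (x, b)] @ u" "word_inv u @ u" "[]"]
    by (simp add: word_inv_def)
qed

lemma presented_group_is_group: "group (presented_group X R)"
proof (rule groupI)
  fix A B assume "A \<in> carrier (presented_group X R)" "B \<in> carrier (presented_group X R)"
  then show "A \<otimes>\<^bsub>presented_group X R\<^esub> B \<in> carrier (presented_group X R)"
    by (auto simp: carrier_presented_group mult_presented_group)
next
  fix A assume "A \<in> carrier (presented_group X R)"
  then obtain u where u: "u \<in> words X" "A = word_class X R u"
    by (auto simp: carrier_presented_group)
  have "word_class X R (word_inv u @ u) = word_class X R []"
    using u word_inv_left[of u X R] word_inv_words[of u X] by (simp add: word_class_eq_iff)
  then have "word_class X R (word_inv u) \<otimes>\<^bsub>presented_group X R\<^esub> A = \<one>\<^bsub>presented_group X R\<^esub>"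
    using u word_inv_words[of u X] by (simp add: mult_presented_group one_presented_group)
  then show "\<exists>B\<in>carrier (presented_group X R).
      B \<otimes>\<^bsub>presented_group X R\<^esub> A = \<one>\<^bsub>presented_group X R\<^esub>"
    using word_inv_words[OF u(1)] by (auto simp: carrier_presented_group)
next
  show "\<one>\<^bsub>presented_group X R\<^esub> \<in> carrier (presented_group X R)"
    unfolding carrier_presented_group one_presented_group by (rule imageI) simp
next
  fix A assume "A \<in> carrier (presented_group X R)"
  then obtain u where "u \<in> words X" "A = word_class X R u"
    unfolding carrier_presented_group by blast
  then show "\<one>\<^bsub>presented_group X R\<^esub> \<otimes>\<^bsub>presented_group X R\<^esub> A = A"
    by (simp add: one_presented_group mult_presented_group)
next
  fix A B C
  assume "A \<in> carrier (presented_group X R)" "B \<in> carrier (presented_group X R)"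
    "C \<in> carrier (presented_group X R)"
  then obtain u v w where "u \<in> words X" "A = word_class X R u" "v \<in> words X"
    "B = word_class X R v" "w \<in> words X" "C = word_class X R w"
    unfolding carrier_presented_group by blast
  then show "A \<otimes>\<^bsub>presented_group X R\<^esub> B \<otimes>\<^bsub>presented_group X R\<^esub> C =
      A \<otimes>\<^bsub>presented_group X R\<^esub> (B \<otimes>\<^bsub>presented_group X R\<^esub> C)"
    by (simp add: mult_presented_group)
qed

definition word_eval :: "('a, 'm) monoid_scheme \<Rightarrow> ('x \<Rightarrow> 'a) \<Rightarrow> 'x word \<Rightarrow> 'a" where
  "word_eval H f u = foldr (\<lambda>(x, b) h. (if b then f x else inv\<^bsub>H\<^esub> f x) \<otimes>\<^bsub>H\<^esub> h) u \<one>\<^bsub>H\<^esub>"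

context
  fixes H :: "('a, 'm) monoid_scheme" and f :: "'x \<Rightarrow> 'a" and X :: "'x set"
  assumes H: "group H" and f: "\<And>x. x \<in> X \<Longrightarrow> f x \<in> carrier H"
begin

interpretation H: group H by (rule H)

lemma word_eval_closed: "u \<in> words X \<Longrightarrow> word_eval H f u \<in> carrier H"
  by (induction u) (auto simp: word_eval_def f)

lemma word_eval_append:
  "u \<in> words X \<Longrightarrow> v \<in> words X \<Longrightarrow>
     word_eval H f (u @ v) = word_eval H f u \<otimes>\<^bsub>H\<^esub> word_eval H f v"
proof (induction u)
  case Nil
  then show ?case using word_eval_closed[of v] by (simp add: word_eval_def)
next
  case (Cons a u)
  then show ?case
    using word_eval_closed[of u] word_eval_closed[of v]
    by (cases a) (simp add: word_eval_def f H.m_assoc)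
qed

lemma word_eval_pres_eq:
  assumes R: "\<And>r. r \<in> R \<Longrightarrow> word_eval H f r = \<one>\<^bsub>H\<^esub>"
  shows "pres_eq X R u v \<Longrightarrow> word_eval H f u = word_eval H f v"
proof (induction rule: pres_eq.induct)
  case (cancel u v x b)
  have "word_eval H f [(x, b), (x, \<not> b)] = \<one>\<^bsub>H\<^esub>"
    using cancel f by (simp add: word_eval_def)
  then show ?case
    using cancel by (simp add: word_eval_append word_eval_closed del: append_Cons append_Nil)
next
  case (relator u v r)
  then show ?case by (simp add: R word_eval_append word_eval_closed)
qed simp_all

text \<open>The universal property of a presentation.\<close>

lemma presented_group_universal:
  assumes R: "\<And>r. r \<in> R \<Longrightarrow> word_eval H f r = \<one>\<^bsub>H\<^esub>"
  shows "\<exists>\<phi>\<in>hom (presented_group X R) H. \<forall>x\<in>X. \<phi> (word_class X R [(x, True)]) = f x"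
proof -
  define \<phi> where "\<phi> A = word_eval H f (SOME u. u \<in> A)" for A
  have \<phi>: "\<phi> (word_class X R u) = word_eval H f u" if "u \<in> words X" for u
  proof -
    have "(SOME v. v \<in> word_class X R u) \<in> word_class X R u"
      by (rule someI[of _ u]) (simp add: word_class_def pres_eq.refl that)
    then show ?thesis
      using word_eval_pres_eq[OF R] by (metis \<phi>_def mem_Collect_eq word_class_def)
  qed
  have "\<phi> \<in> hom (presented_group X R) H"
    by (rule homI)
      (auto simp: carrier_presented_group mult_presented_group \<phi> word_eval_append word_eval_closed)
  moreover have "\<forall>x\<in>X. \<phi> (word_class X R [(x, True)]) = f x"
    using f by (simp add: \<phi> word_eval_def)
  ultimately show ?thesis by blast
qed

end


section \<open>The surface group of genus \<open>g\<close>\<close>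

datatype surface_letter = A nat | B nat

definition surface_letters :: "nat \<Rightarrow> surface_letter set" where
  "surface_letters g = A ` {1..g} \<union> B ` {1..g}"

definition surface_relator :: "nat \<Rightarrow> surface_letter word" where
  "surface_relator g =
     concat (map (\<lambda>i. [(A i, True), (B i, True), (A i, False), (B i, False)]) [1..<Suc g])"

definition surface_group :: "nat \<Rightarrow> surface_letter word set monoid" where
  "surface_group g = presented_group (surface_letters g) {surface_relator g}"

definition surface_gens :: "nat \<Rightarrow> surface_letter word set set" where
  "surface_gens g =
     (\<lambda>x. word_class (surface_letters g) {surface_relator g} [(x, True)]) ` surface_letters g"

text \<open>
  The inductive rule for relators requires them to be words over the given generators, which the
  surface relator is.
\<close>

lemma surface_relator_words: "surface_relator g \<in> words (surface_letters g)"
  by (auto simp: surface_relator_def surface_letters_def words_def)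

end

theory Submission
  imports Defs
begin

text \<open>
  Cut the surface along a cyclic chain of \<open>2 g + 2\<close> simple closed curves, alternately red and blue,
  in which consecutive curves meet once and all others are disjoint. Recording the curves that a loop
  crosses maps the surface group to the right-angled Artin group in which intersecting curves commute,
  and with a suitable marking every standard generator crosses at most four curves. A path of
  crossings whose image is not reduced can be shortened by a homotopy across the squares at the
  intersection points. So a nontrivial element of length \<open>l\<close> is given by a nonempty reduced word of
  length \<open>n \<le> 4 l\<close>. Since crossings of one colour alternate in sign, no letter of that word can be
  brought next to an equal one, so its Magnus expansion (with squares of the variables set to zero)
  has coefficient \<open>1\<close> or \<open>- 1\<close> at the word itself. Elements of the \<open>k\<close>-th term of the lower central
  series have no terms of positive degree below \<open>k\<close>, hence \<open>k \<le> n\<close>.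
\<close>

section \<open>Magnus representation of a right-angled Artin group\<close>

datatype curve = Red nat | Blue nat

text \<open>For indices up to \<open>g\<close> this is the cyclic chain Red 0, Blue 0, Red 1, Blue
  1, ..., Red g, Blue g, closed up by Blue g meeting Red 0.\<close>

fun crosses :: "nat \<Rightarrow> curve \<Rightarrow> curve \<Rightarrow> bool" where
  "crosses g (Red i) (Blue j) \<longleftrightarrow> (if i = 0 then j = 0 \<or> j = g else j = i \<or> Suc j = i)"
| "crosses g (Blue j) (Red i) \<longleftrightarrow> (if i = 0 then j = 0 \<or> j = g else j = i \<or> Suc j = i)"
| "crosses g (Red _) (Red _) \<longleftrightarrow> False"
| "crosses g (Blue _) (Blue _) \<longleftrightarrow> False"

lemma crosses_sym: "crosses g c d \<longleftrightarrow> crosses g d c"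
  by (cases c; cases d) auto

lemma not_crosses_self [simp]: "\<not> crosses g c c"
  by (cases c) auto

type_synonym crossing = "curve \<times> bool"

text \<open>These are the integer functionals, given by their values on monomials, on the ring with
  variables x_c, where x_c x_d = x_d x_c for crossing curves and x_c^2 = 0. Working in the dual
  avoids building the quotient ring.\<close>

definition trace_functions :: "nat \<Rightarrow> (curve list \<Rightarrow> int) set" where
  "trace_functions g =
     {f. (\<forall>t u c d. crosses g c d \<longrightarrow> f (t @ c # d # u) = f (t @ d # c # u)) \<and>
         (\<forall>t u c. f (t @ c # c # u) = 0)}"

text \<open>The transpose of right multiplication by 1 + x_c or 1 - x_c. Hence
  \<open>acts u f t\<close> is \<open>f\<close> evaluated at \<open>t\<close> times the Magnus
  expansion of \<open>u\<close>, with the order of the letters kept.\<close>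

definition act :: "crossing \<Rightarrow> (curve list \<Rightarrow> int) \<Rightarrow> curve list \<Rightarrow> int" where
  "act l f = (\<lambda>t. f t + (if snd l then 1 else - 1) * f (t @ [fst l]))"

abbreviation acts :: "crossing list \<Rightarrow> (curve list \<Rightarrow> int) \<Rightarrow> curve list \<Rightarrow> int" where
  "acts u f \<equiv> foldr act u f"

lemma trace_functionsI:
  assumes "\<And>t u c d. crosses g c d \<Longrightarrow> f (t @ c # d # u) = f (t @ d # c # u)"
    and "\<And>t u c. f (t @ c # c # u) = 0"
  shows "f \<in> trace_functions g"
  using assms unfolding trace_functions_def by blast

lemma trace_functionsD:
  assumes "f \<in> trace_functions g"
  shows "crosses g c d \<Longrightarrow> f (t @ c # d # u) = f (t @ d # c # u)"
    and "f (t @ c # c # u) = 0"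
  using assms unfolding trace_functions_def by blast+

lemma act_trace_functions [simp]:
  assumes "f \<in> trace_functions g"
  shows "act l f \<in> trace_functions g"
proof (rule trace_functionsI)
  fix t u c d assume "crosses g c d"
  then show "act l f (t @ c # d # u) = act l f (t @ d # c # u)"
    using trace_functionsD(1)[OF assms, of c d t u]
      trace_functionsD(1)[OF assms, of c d t "u @ [fst l]"] by (simp add: act_def)
next
  fix t u c
  show "act l f (t @ c # c # u) = 0"
    using trace_functionsD(2)[OF assms, of t c u]
      trace_functionsD(2)[OF assms, of t c "u @ [fst l]"] by (simp add: act_def)
qed

lemma trace_functions_add:
  assumes "f \<in> trace_functions g" "h \<in> trace_functions g"
  shows "(\<lambda>t. f t + h t) \<in> trace_functions g"
  by (rule trace_functionsI) (simp_all add: assms[THEN trace_functionsD(2)],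
      metis assms trace_functionsD(1))

lemma trace_functions_diff:
  assumes "f \<in> trace_functions g" "h \<in> trace_functions g"
  shows "(\<lambda>t. f t - h t) \<in> trace_functions g"
  by (rule trace_functionsI) (simp_all add: assms[THEN trace_functionsD(2)],
      metis assms trace_functionsD(1))

lemma acts_trace_functions [simp]:
  "f \<in> trace_functions g \<Longrightarrow> acts u f \<in> trace_functions g"
  by (induction u) auto

text \<open>(1 + x_c)(1 - x_c) = 1 because x_c^2 = 0.\<close>

lemma act_act_inverse:
  assumes "f \<in> trace_functions g"
  shows "act (c, s) (act (c, \<not> s) f) = f"
proof
  fix t
  have "f (t @ c # c # []) = 0"
    using assms unfolding trace_functions_def by blast
  then show "act (c, s) (act (c, \<not> s) f) t = f t"
    by (simp add: act_def)
qed

lemma act_act_commute: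
  assumes "f \<in> trace_functions g" "crosses g c d"
  shows "act (c, s) (act (d, r) f) = act (d, r) (act (c, s) f)"
proof
  fix t
  have "f (t @ c # d # []) = f (t @ d # c # [])"
    using assms unfolding trace_functions_def by blast
  then show "act (c, s) (act (d, r) f) t = act (d, r) (act (c, s) f) t"
    by (simp add: act_def algebra_simps)
qed

lemma acts_cancel:
  assumes "f \<in> trace_functions g" "\<forall>l\<in>set v. crosses g c (fst l)"
  shows "acts ((c, s) # v @ (c, \<not> s) # q) f = acts (v @ q) f"
  using assms(2)
proof (induction v)
  case Nil
  then show ?case using act_act_inverse[of "acts q f" g c s] assms(1) by simp
next
  case (Cons l v)
  then show ?case
    using act_act_commute[of "acts (v @ (c, \<not> s) # q) f" g c "fst l" s "snd l"] assms(1)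
    by simp
qed

lemma acts_add: "acts u (\<lambda>t. f t + h t) = (\<lambda>t. acts u f t + acts u h t)"
  by (induction u) (auto simp: act_def algebra_simps)

text \<open>Dual form of the degree filtration. The bound is an integer so that it can be lowered
  freely: a negative bound leaves only the zero function.\<close>

definition bounded_traces :: "nat \<Rightarrow> int \<Rightarrow> (curve list \<Rightarrow> int) set" where
  "bounded_traces g n = {f \<in> trace_functions g. \<forall>t. n < int (length t) \<longrightarrow> f t = 0}"

lemma bounded_traces_diff:
  "f \<in> bounded_traces g n \<Longrightarrow> h \<in> bounded_traces g n \<Longrightarrow> (\<lambda>t. f t - h t) \<in> bounded_traces g n"
  by (simp add: bounded_traces_def trace_functions_diff)

lemma bounded_traces_add:
  "f \<in> bounded_traces g n \<Longrightarrow> h \<in> bounded_traces g n \<Longrightarrow> (\<lambda>t. f t + h t) \<in> bounded_traces g n"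
  by (simp add: bounded_traces_def trace_functions_add)

lemma bounded_traces_mono: "f \<in> bounded_traces g m \<Longrightarrow> m \<le> n \<Longrightarrow> f \<in> bounded_traces g n"
  by (simp add: bounded_traces_def)

lemma act_bounded_traces:
  assumes "f \<in> bounded_traces g n"
  shows "(\<lambda>t. act l f t - f t) \<in> bounded_traces g (n - 1)"
proof -
  have "act l f \<in> trace_functions g" "f \<in> trace_functions g"
    using assms by (auto simp: bounded_traces_def)
  then have "(\<lambda>t. act l f t - f t) \<in> trace_functions g"
    by (rule trace_functions_diff)
  then show ?thesis
    using assms by (simp add: bounded_traces_def act_def)
qed

text \<open>Telescoping over the letters of \<open>u\<close>: each one changes the function by a
  term supported one degree lower.\<close>

lemma acts_bounded_traces:
  assumes "f \<in> bounded_traces g n"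
  shows "acts u f \<in> bounded_traces g n \<and> (\<lambda>t. acts u f t - f t) \<in> bounded_traces g (n - 1)"
proof (induction u)
  case Nil
  then show ?case using assms bounded_traces_diff[OF assms assms]
    by (simp add: bounded_traces_def)
next
  case (Cons l u)
  have 1: "(\<lambda>t. act l (acts u f) t - acts u f t) \<in> bounded_traces g (n - 1)"
    using Cons act_bounded_traces by blast
  from bounded_traces_add[OF 1 conjunct2[OF Cons]]
  have 2: "(\<lambda>t. acts (l # u) f t - f t) \<in> bounded_traces g (n - 1)" by simp
  from bounded_traces_add[OF assms bounded_traces_mono[OF this, of n]] 2
  show ?case by simp
qed

text \<open>
  Swapping two commuting letters leaves every \<open>occurrences g c\<close> unchanged: at most one of them is
  kept unless both differ from \<open>c\<close>. So this datum separates traces without a quotient of words.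
\<close>

definition occurrences :: "nat \<Rightarrow> curve \<Rightarrow> curve list \<Rightarrow> bool list" where
  "occurrences g c t = map (\<lambda>d. d = c) (filter (\<lambda>d. \<not> crosses g c d) t)"

text \<open>Two adjacent \<open>True\<close> entries are two copies of \<open>c\<close> with only
  letters commuting with \<open>c\<close> between them, which swaps could bring together. Rigid
  words are the reduced ones.\<close>

definition rigid :: "nat \<Rightarrow> curve list \<Rightarrow> bool" where
  "rigid g t \<longleftrightarrow> (\<forall>c P Q. occurrences g c t \<noteq> P @ True # True # Q)"

text \<open>Plays the role of the functional reading off the coefficient of the monomial
  \<open>s\<close>; the length clause fixes its degree.\<close>

definition trace_indicator :: "nat \<Rightarrow> curve list \<Rightarrow> curve list \<Rightarrow> int" where
  "trace_indicator g s t =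
     of_bool (length t = length s \<and> (\<forall>c. occurrences g c t = occurrences g c s))"

lemma trace_indicator_bounded:
  assumes "rigid g s"
  shows "trace_indicator g s \<in> bounded_traces g (int (length s))"
proof -
  have swap: "occurrences g e (t @ c # d # u) = occurrences g e (t @ d # c # u)"
    if "crosses g c d" for t u c d e
    using that by (auto simp: occurrences_def crosses_sym)
  \<comment> \<open>The pair \<open>c # c\<close> leaves two adjacent \<open>True\<close> entries in
    the datum for \<open>c\<close>, which rigidity of \<open>s\<close> excludes.\<close>
  have square: "occurrences g c (t @ c # c # u) \<noteq> occurrences g c s" for t u c
    using assms unfolding rigid_def by (simp add: occurrences_def) metis
  have "trace_indicator g s \<in> trace_functions g"
  proof (rule trace_functionsI)
    fix t u c d assume "crosses g c d"
    from swap[OF this, of _ t u]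
    show "trace_indicator g s (t @ c # d # u) = trace_indicator g s (t @ d # c # u)"
      unfolding trace_indicator_def by simp
  next
    fix t u c
    have "\<not> (\<forall>e. occurrences g e (t @ c # c # u) = occurrences g e s)"
      using square[of c t u] by (rule contrapos_nn) (rule spec)
    then show "trace_indicator g s (t @ c # c # u) = 0"
      by (simp only: trace_indicator_def simp_thms of_bool_eq)
  qed
  then show ?thesis
    by (auto simp: bounded_traces_def trace_indicator_def)
qed

text \<open>Expanding the product, a term that omits a letter of \<open>u\<close> gives a word
  shorter than \<open>n\<close>, where \<open>f\<close> vanishes; only the full word survives, up to
  sign. The first conjunct removes the omitted-letter term in the induction.\<close>

lemma acts_top_degree:
  assumes "\<And>t. length t < n \<Longrightarrow> f t = 0"
  shows "(length t + length u < n \<longrightarrow> acts u f t = 0) \<and>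
    (length t + length u = n \<longrightarrow> \<bar>acts u f t\<bar> = \<bar>f (t @ map fst u)\<bar>)"
proof (induction u arbitrary: t)
  case Nil
  then show ?case using assms by simp
next
  case (Cons l u)
  from Cons[of t] Cons[of "t @ [fst l]"] show ?case
    by (auto simp: act_def)
qed

lemma rigid_detected:
  assumes "rigid g (map fst u)" "u \<noteq> []"
  shows "acts u (trace_indicator g (map fst u)) [] \<noteq> trace_indicator g (map fst u) []"
proof -
  have "\<bar>acts u (trace_indicator g (map fst u)) []\<bar> = 1"
    using acts_top_degree[of "length u" "trace_indicator g (map fst u)" "[]" u]
    by (simp add: trace_indicator_def)
  moreover have "trace_indicator g (map fst u) [] = 0"
    using assms(2) by (simp add: trace_indicator_def)
  ultimately show ?thesis by auto
qed


section \<open>Paths crossing the curves\<close>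

text \<open>
  The curves cut the surface into four polygons, indexed by pairs of truth values. Every red curve
  separates the polygons \<open>(False, q)\<close> from \<open>(True, q)\<close>, every blue one \<open>(p, False)\<close> from
  \<open>(p, True)\<close>, and the sign of a crossing is the side on which it ends.
\<close>

fun crossable :: "nat \<Rightarrow> bool \<times> bool \<Rightarrow> crossing \<Rightarrow> bool" where
  "crossable g (p, q) (Red i, s) \<longleftrightarrow> i \<le> g \<and> p = (\<not> s)"
| "crossable g (p, q) (Blue j, s) \<longleftrightarrow> j \<le> g \<and> q = (\<not> s)"

fun cross :: "bool \<times> bool \<Rightarrow> crossing \<Rightarrow> bool \<times> bool" where
  "cross (p, q) (Red i, s) = (s, q)"
| "cross (p, q) (Blue j, s) = (p, s)"

fun path :: "nat \<Rightarrow> bool \<times> bool \<Rightarrow> crossing list \<Rightarrow> bool" where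
  "path g x [] \<longleftrightarrow> True"
| "path g x (l # u) \<longleftrightarrow> crossable g x l \<and> path g (cross x l) u"

abbreviation path_end :: "bool \<times> bool \<Rightarrow> crossing list \<Rightarrow> bool \<times> bool" where
  "path_end x u \<equiv> foldl cross x u"

lemma path_append: "path g x (u @ v) \<longleftrightarrow> path g x u \<and> path g (path_end x u) v"
  by (induction u arbitrary: x) auto

lemma cross_commute:
  assumes "crosses g c d"
  shows "cross (cross x (c, s)) (d, r) = cross (cross x (d, r)) (c, s)"
    and "crossable g (cross x (c, s)) (d, r) \<longleftrightarrow> crossable g x (d, r)"
  using assms by (cases x; cases c; cases d; auto)+

text \<open>The letters of \<open>v\<close> have the other colour, so they do not change the side of
  \<open>c\<close>: the second crossing of \<open>c\<close> starts where the first one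
  ended.\<close>

lemma path_same_curve:
  assumes "path g x ((c, s) # v @ (c, s') # q)" "\<forall>l\<in>set v. crosses g c (fst l)"
  shows "s' = (\<not> s)"
  using assms
proof (induction v arbitrary: x)
  case Nil
  then show ?case by (cases x; cases c) auto
next
  case (Cons l v)
  obtain d r where l: "l = (d, r)" by (cases l)
  have "path g (cross x l) ((c, s) # v @ (c, s') # q)"
    using Cons.prems cross_commute[of g c d x s r] cross_commute(2)[of g d c x r s] crosses_sym[of g c d] by (simp add: l)
  then show ?case using Cons by auto
qed

lemma path_cancel:
  assumes "path g x ((c, s) # v @ (c, \<not> s) # q)" "\<forall>l\<in>set v. crosses g c (fst l)"
  shows "path g x (v @ q)"
  using assms
proof (induction v arbitrary: x)
  case Nil
  then show ?case by (cases x; cases c) auto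
next
  case (Cons l v)
  obtain d r where l: "l = (d, r)" by (cases l)
  show ?case
    using Cons.prems cross_commute[of g c d x s r] cross_commute(2)[of g d c x r s] crosses_sym[of g c d] Cons.IH[of "cross x l"] by (simp add: l)
qed

lemma filter_eq_appendE:
  assumes "filter P xs = ys @ zs"
  obtains us vs where "xs = us @ vs" "filter P us = ys" "filter P vs = zs"
  using assms
proof (induction ys arbitrary: xs thesis)
  case Nil
  from Nil.prems(1)[of "[]" xs] Nil.prems(2) show ?case by simp
next
  case (Cons y ys)
  then obtain us vs where xs: "xs = us @ y # vs" "\<forall>u\<in>set us. \<not> P u" "P y" "filter P vs = ys @ zs"
    by (auto simp: filter_eq_Cons_iff)
  obtain us' vs' where "vs = us' @ vs'" "filter P us' = ys" "filter P vs' = zs"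
    using Cons.IH[OF _ xs(4)] by blast
  then show ?case using Cons.prems(1)[of "us @ y # us'" vs'] xs by simp
qed

text \<open>Successive crossings of curves of one colour have alternating signs, so a repetition of a
  curve that only commuting letters separate is a cancelling pair.\<close>

lemma not_rigid_pathE:
  assumes "path g x u" "\<not> rigid g (map fst u)"
  obtains p c s v q where "u = p @ (c, s) # v @ (c, \<not> s) # q" "\<forall>l\<in>set v. crosses g c (fst l)"
proof -
  obtain c P Q where "occurrences g c (map fst u) = P @ True # True # Q"
    using assms(2) by (auto simp: rigid_def)
  then have "map (\<lambda>l. fst l = c) (filter (\<lambda>l. \<not> crosses g c (fst l)) u) = P @ True # True # Q"
    by (simp add: occurrences_def filter_map comp_def)
  then obtain l l' P' Q' where "filter (\<lambda>l. \<not> crosses g c (fst l)) u = P' @ l # l' # Q'"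
    and l: "fst l = c" "fst l' = c"
    by (auto simp: map_eq_append_conv map_eq_Cons_conv)
  then obtain p w where u: "u = p @ w" "filter (\<lambda>l. \<not> crosses g c (fst l)) w = l # l' # Q'"
    by (metis filter_eq_appendE)
  then obtain p' w' where w: "w = p' @ l # w'" "filter (\<lambda>l. \<not> crosses g c (fst l)) w' = l' # Q'"
    by (metis filter_eq_Cons_iff)
  then obtain v q where v: "w' = v @ l' # q" "\<forall>l\<in>set v. crosses g c (fst l)"
    by (auto simp: filter_eq_Cons_iff)
  have eq: "u = (p @ p') @ (c, snd l) # v @ (c, snd l') # q"
    using u w v l by (auto simp: prod_eq_iff)
  have "path g (path_end x (p @ p')) ((c, snd l) # v @ (c, snd l') # q)"
    using assms(1) unfolding eq path_append by blast
  then have "snd l' = (\<not> snd l)"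
    using v(2) by (rule path_same_curve)
  then show ?thesis using that[of "p @ p'" c "snd l" v q] eq v(2) by simp
qed


section \<open>Holonomy\<close>

locale surface_tuple = group G for G (structure) +
  fixes g :: nat and a b :: "nat \<Rightarrow> 'a"
  assumes a_closed [simp]: "a i \<in> carrier G"
    and b_closed [simp]: "b i \<in> carrier G"
begin

lemma cancel_left [simp]:
  "x \<in> carrier G \<Longrightarrow> y \<in> carrier G \<Longrightarrow> x \<otimes> (inv x \<otimes> y) = y"
  "x \<in> carrier G \<Longrightarrow> y \<in> carrier G \<Longrightarrow> inv x \<otimes> (x \<otimes> y) = y"
  by (simp_all add: m_assoc[symmetric])

fun relator_prefix :: "nat \<Rightarrow> 'a" where
  "relator_prefix 0 = \<one>"
| "relator_prefix (Suc i) = relator_prefix i \<otimes> commutator G (a (Suc i)) (b (Suc i))"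

text \<open>The holonomy across \<open>Blue i\<close> from the polygon
  \<open>(False, False)\<close>. The recursion is chosen so that crossing
  \<open>Blue (i - 1)\<close> and returning across \<open>Blue i\<close> gives
  \<open>a i\<close>.\<close>

fun blue :: "nat \<Rightarrow> 'a" where
  "blue 0 = \<one>"
| "blue (Suc i) = inv (a (Suc i)) \<otimes> blue i"

lemma prefix_closed [simp]: "relator_prefix i \<in> carrier G"
  by (induction i) (auto simp: commutator_def)

lemma blue_closed [simp]: "blue i \<in> carrier G"
  by (induction i) auto

text \<open>The holonomy is normalised to be trivial on the edges that cross \<open>Red 0\<close> or \<open>Blue 0\<close>; the
  squares at the intersection points then force the remaining values.\<close>

fun edge :: "bool \<times> bool \<Rightarrow> curve \<Rightarrow> 'a" where
  "edge (p, q) (Blue j) = (if p then relator_prefix j \<otimes> blue j else blue j)"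
| "edge (p, q) (Red i) =
     (if i = 0 then \<one>
      else if q then inv (blue i) \<otimes> inv (b i) \<otimes> blue i
      else inv (b i) \<otimes> inv (relator_prefix i))"

definition step :: "bool \<times> bool \<Rightarrow> crossing \<Rightarrow> 'a" where
  "step x l = (if snd l then edge x (fst l) else inv (edge x (fst l)))"

fun holonomy :: "bool \<times> bool \<Rightarrow> crossing list \<Rightarrow> 'a" where
  "holonomy x [] = \<one>"
| "holonomy x (l # u) = step x l \<otimes> holonomy (cross x l) u"

lemma edge_closed [simp]: "edge x c \<in> carrier G"
  by (cases x; cases c) auto

lemma step_closed [simp]: "step x l \<in> carrier G"
  by (simp add: step_def)

lemma holonomy_closed [simp]: "holonomy x u \<in> carrier G"
  by (induction u arbitrary: x) auto

lemma holonomy_append: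
  "holonomy x (u @ v) = holonomy x u \<otimes> holonomy (path_end x u) v"
  by (induction u arbitrary: x) (auto simp: m_assoc)

context
  assumes relation: "relator_prefix g = \<one>"
begin

text \<open>The two ways round an intersection point agree. The surface relation enters only where
  \<open>Red 0\<close> meets \<open>Blue g\<close>. The free truth values are allowed because an
  edge ignores the coordinate that its own curve changes.\<close>

lemma square:
  assumes "crosses g (Red i) (Blue j)"
  shows "edge (p, False) (Red i) \<otimes> edge (True, q) (Blue j) =
    edge (False, q') (Blue j) \<otimes> edge (p', True) (Red i)"
proof -
  consider "i = 0" "relator_prefix j = \<one>" | k where "i = Suc k" "j = Suc k" | "i = Suc j"
    using assms relation by (cases i) (auto split: if_splits)
  then show ?thesis
  proof cases
    case 1
    then show ?thesis by simp
  next
    case 2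
    then show ?thesis by (simp add: m_assoc del: relator_prefix.simps blue.simps)
  next
    case 3
    then show ?thesis by (simp add: m_assoc inv_mult_group commutator_def)
  qed
qed

lemma step_commute_Red_Blue:
  assumes "crosses g (Red i) (Blue j)" "crossable g x (Red i, s)" "crossable g x (Blue j, r)"
  shows "step x (Red i, s) \<otimes> step (cross x (Red i, s)) (Blue j, r) =
    step x (Blue j, r) \<otimes> step (cross x (Blue j, r)) (Red i, s)"
proof -
  have x: "x = (\<not> s, \<not> r)" using assms(2,3) by (cases x) auto
  \<comment> \<open>The same square read from its other three corners, one for each remaining choice
    of signs.\<close>
  have swap: "y \<otimes> inv w = inv z \<otimes> u \<and> inv u \<otimes> z = w \<otimes> inv y \<and> inv y \<otimes> inv z = inv w \<otimes> inv u"
    if sq: "u \<otimes> w = z \<otimes> y"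
      and closed: "u \<in> carrier G" "w \<in> carrier G" "z \<in> carrier G" "y \<in> carrier G" for u w z y
  proof -
    have u: "u = z \<otimes> (y \<otimes> inv w)"
      using sq closed by (metis inv_closed m_assoc r_inv r_one)
    then show ?thesis using closed by (simp add: inv_mult_group m_assoc)
  qed
  note sq = square[OF assms(1)]
  show ?thesis
    using sq swap[OF sq] by (cases s; cases r) (simp_all add: x step_def del: edge.simps)
qed

lemma step_commute:
  assumes "crosses g c d" "crossable g x (c, s)" "crossable g x (d, r)"
  shows "step x (c, s) \<otimes> step (cross x (c, s)) (d, r) =
    step x (d, r) \<otimes> step (cross x (d, r)) (c, s)"
proof (cases c)
  case (Red i)
  then obtain j where "d = Blue j" using assms(1) by (cases d) auto
  then show ?thesis using assms step_commute_Red_Blue Red by simp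
next
  case (Blue j)
  then obtain i where "d = Red i" using assms(1) by (cases d) auto
  then show ?thesis using assms step_commute_Red_Blue[of i j x r s] Blue by simp
qed

lemma holonomy_cancel:
  assumes "path g x ((c, s) # v @ (c, \<not> s) # q)" "\<forall>l\<in>set v. crosses g c (fst l)"
  shows "holonomy x ((c, s) # v @ (c, \<not> s) # q) = holonomy x (v @ q)
    \<and> path_end x ((c, s) # v @ (c, \<not> s) # q) = path_end x (v @ q)"
  using assms
proof (induction v arbitrary: x)
  case Nil
  obtain p q' where x: "x = (p, q')" by (cases x)
  have "cross (cross x (c, s)) (c, \<not> s) = x" using Nil by (cases c) (auto simp: x)
  moreover have "step x (c, s) \<otimes> step (cross x (c, s)) (c, \<not> s) = \<one>"
    using Nil by (cases c) (auto simp: x step_def)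
  ultimately show ?case by (simp add: m_assoc[symmetric])
next
  case (Cons l v)
  obtain d r where l: "l = (d, r)" by (cases l)
  have cr: "crosses g c d" "crossable g x (c, s)" "crossable g x (d, r)"
    using Cons.prems cross_commute[of g c d x s r] by (auto simp: l)
  have "path g (cross x l) ((c, s) # v @ (c, \<not> s) # q)"
    using Cons.prems cross_commute[of g c d x s r] cross_commute(2)[of g d c x r s]
      crosses_sym[of g c d] by (simp add: l)
  then have IH: "holonomy (cross x l) ((c, s) # v @ (c, \<not> s) # q) = holonomy (cross x l) (v @ q)"
    "path_end (cross x l) ((c, s) # v @ (c, \<not> s) # q) = path_end (cross x l) (v @ q)"
    using Cons by auto
  have "holonomy x ((c, s) # (l # v) @ (c, \<not> s) # q) =
      (step x (c, s) \<otimes> step (cross x (c, s)) (d, r)) \<otimes>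
      holonomy (cross (cross x (c, s)) (d, r)) (v @ (c, \<not> s) # q)"
    by (simp add: l m_assoc)
  also have "\<dots> = step x l \<otimes> holonomy (cross x l) ((c, s) # v @ (c, \<not> s) # q)"
    using step_commute[OF cr] cross_commute(1)[OF cr(1)] by (simp add: l m_assoc)
  finally show ?case
    using IH cross_commute(1)[OF cr(1), of x s r] by (simp add: l)
qed

text \<open>A path that is not rigid contains a cancelling pair. Deleting it shortens the path and
  preserves being a path, the holonomy and the Magnus action, so the process can be
  repeated.\<close>

lemma rigid_representative:
  assumes "path g x u"
  shows "\<exists>v. path g x v \<and> length v \<le> length u \<and> rigid g (map fst v) \<and>
    holonomy x v = holonomy x u \<and> (\<forall>f\<in>trace_functions g. acts v f = acts u f)"
  using assms
proof (induction "length u" arbitrary: u rule: less_induct)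
  case less
  show ?case
  proof (cases "rigid g (map fst u)")
    case True
    then show ?thesis using less.prems by blast
  next
    case False
    then obtain p c s v q where u: "u = p @ (c, s) # v @ (c, \<not> s) # q"
      and v: "\<forall>l\<in>set v. crosses g c (fst l)"
      using not_rigid_pathE[OF less.prems] by blast
    let ?u = "p @ v @ q"
    have path: "path g (path_end x p) ((c, s) # v @ (c, \<not> s) # q)"
      using less.prems by (simp add: u path_append)
    have "path g x ?u"
      using less.prems path_cancel[OF path v] by (simp add: u path_append)
    moreover have "length ?u < length u" by (simp add: u)
    ultimately obtain w where w: "path g x w" "length w \<le> length ?u" "rigid g (map fst w)"
      "holonomy x w = holonomy x ?u" "\<forall>f\<in>trace_functions g. acts w f = acts ?u f"
      using less.hyps by blast
    have "holonomy x ?u = holonomy x u"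
      using holonomy_cancel[OF path v] by (simp only: u holonomy_append)
    moreover have "acts ?u f = acts u f" if "f \<in> trace_functions g" for f
      using acts_cancel[OF that v, of s q] by (simp add: u)
    ultimately show ?thesis
      using w by (intro exI[of _ w]) (auto simp: u)
  qed
qed

end

end


section \<open>Words in the standard generators\<close>

text \<open>Loops based at the polygon \<open>(False, False)\<close> whose holonomies are the
  generators and their inverses. The four crossings of a \<open>B\<close> letter are the source of
  the constant 1/4.\<close>

fun crossings :: "surface_letter \<times> bool \<Rightarrow> crossing list" where
  "crossings (A i, s) = (if s then [(Blue (i - 1), True), (Blue i, False)]
     else [(Blue i, True), (Blue (i - 1), False)])"
| "crossings (B i, s) = (if s then [(Blue i, True), (Red 0, True), (Red i, False), (Blue i, False)]
     else [(Blue i, True), (Red i, True), (Red 0, False), (Blue i, False)])"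

abbreviation crossing_word :: "surface_letter word \<Rightarrow> crossing list" where
  "crossing_word u \<equiv> concat (map crossings u)"

lemma crossing_word_path:
  assumes "u \<in> words (surface_letters g)"
  shows "path g (False, False) (crossing_word u) \<and>
    path_end (False, False) (crossing_word u) = (False, False)"
  using assms
proof (induction u)
  case (Cons l u)
  obtain c s where l: "l = (c, s)" by (cases l)
  show ?case using Cons
    by (cases c) (auto simp: l path_append surface_letters_def)
qed simp

lemma length_crossing_word: "length (crossing_word u) \<le> 4 * length u"
proof (induction u)
  case (Cons l u)
  have "length (crossings l) \<le> 4" by (cases l rule: crossings.cases) auto
  then show ?case using Cons by simp
qed simp

lemma (in surface_tuple) holonomy_crossings:
  assumes "i \<ge> 1"
  shows "holonomy (False, False) (crossings (A i, True)) = a i"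
    "holonomy (False, False) (crossings (A i, False)) = inv a i"
    "holonomy (False, False) (crossings (B i, True)) = b i"
    "holonomy (False, False) (crossings (B i, False)) = inv b i"
proof -
  obtain k where "i = Suc k" using assms by (cases i) auto
  then show "holonomy (False, False) (crossings (A i, True)) = a i"
    "holonomy (False, False) (crossings (A i, False)) = inv a i"
    "holonomy (False, False) (crossings (B i, True)) = b i"
    "holonomy (False, False) (crossings (B i, False)) = inv b i"
    by (simp_all add: step_def inv_mult_group m_assoc)
qed

lemma crossings_inverse:
  assumes "f \<in> trace_functions g"
  shows "acts (crossings (x, s) @ crossings (x, \<not> s)) f = f"
  using assms act_act_inverse[of _ g _ True] act_act_inverse[of _ g _ False]
  by (cases x; cases s) simp_all

section \<open>The surface relator acts trivially\<close>

lemma surface_relator_simps [simp]: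
  "surface_relator 0 = []"
  "surface_relator (Suc m) =
     surface_relator m @ [(A (Suc m), True), (B (Suc m), True), (A (Suc m), False), (B (Suc m), False)]"
  by (simp_all add: surface_relator_def)

text \<open>Let s_i be the conjugate of Red 0 by Blue i. Since Red i commutes with Blue (i - 1) and
  Blue i, the image of [a_i, b_i] is s_(i-1) s_i^-1, and the product telescopes to s_0
  s_m^-1.\<close>

lemma acts_surface_relator_prefix:
  assumes "f \<in> trace_functions g"
  shows "acts (crossing_word (surface_relator m)) f =
    acts [(Blue 0, True), (Red 0, True), (Blue 0, False), (Blue m, True), (Red 0, False), (Blue m, False)] f"
  using assms
proof (induction m arbitrary: f)
  case 0
  then show ?case
    using act_act_inverse[of _ g _ True] act_act_inverse[of _ g _ False] by simp
next
  case (Suc m)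
  note inverse = act_act_inverse[of _ g _ True, simplified] act_act_inverse[of _ g _ False, simplified]
  define h where "h = act (Red 0, False) (act (Blue (Suc m), False) f)"
  have h: "h \<in> trace_functions g" using Suc.prems by (simp add: h_def)
  have "acts (crossing_word (surface_relator (Suc m))) f =
    acts (crossing_word (surface_relator m)) (act (Blue m, True) (act (Red 0, True)
      (act (Red (Suc m), False) (act (Blue m, False) (act (Blue (Suc m), True)
      (act (Red (Suc m), True) h))))))"
    using Suc.prems by (simp add: inverse h_def)
  also have "act (Blue (Suc m), True) (act (Red (Suc m), True) h) =
      act (Red (Suc m), True) (act (Blue (Suc m), True) h)"
    by (rule act_act_commute[OF h]) simp
  also have "act (Blue m, False) (act (Red (Suc m), True) (act (Blue (Suc m), True) h)) =
      act (Red (Suc m), True) (act (Blue m, False) (act (Blue (Suc m), True) h))"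
    by (rule act_act_commute[of _ g]) (simp_all add: h)
  also have "act (Red (Suc m), False) \<dots> = act (Blue m, False) (act (Blue (Suc m), True) h)"
    by (simp add: h inverse)
  finally show ?case
    using Suc by (simp add: inverse h h_def)
qed

text \<open>Red 0 commutes with both Blue 0 and Blue g, so the two conjugates left by the
  telescoping cancel.\<close>

lemma acts_surface_relator:
  assumes "f \<in> trace_functions g"
  shows "acts (crossing_word (surface_relator g)) f = f"
proof -
  note inverse = act_act_inverse[of _ g _ True, simplified] act_act_inverse[of _ g _ False, simplified]
  have "act (Red 0, False) (act (Blue g, False) f) = act (Blue g, False) (act (Red 0, False) f)"
    by (rule act_act_commute[OF assms]) simp
  moreover have "act (Red 0, True) (act (Blue 0, False) (act (Red 0, False) f)) =
      act (Blue 0, False) (act (Red 0, True) (act (Red 0, False) f))"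
    by (rule act_act_commute[of _ g]) (simp_all add: assms)
  ultimately show ?thesis
    using acts_surface_relator_prefix[OF assms, of g] assms
    by (simp add: inverse)
qed

lemma acts_pres_eq:
  assumes "pres_eq (surface_letters g) {surface_relator g} u v" "f \<in> trace_functions g"
  shows "acts (crossing_word u) f = acts (crossing_word v) f"
  using assms
proof (induction arbitrary: f)
  case (cancel u v x b)
  then show ?case using crossings_inverse[of "acts (crossing_word v) f" g x b] by simp
next
  case (relator u v r)
  then show ?case using acts_surface_relator[of "acts (crossing_word v) f" g] by simp
qed auto

section \<open>Inverses in presented groups\<close>

lemma word_inv_inv: "word_inv (word_inv u) = u"
  by (induction u) (auto simp: word_inv_def)

lemma word_inv_right: "u \<in> words X \<Longrightarrow> pres_eq X R (u @ word_inv u) []"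
  using word_inv_left[of "word_inv u" X R] by (simp add: word_inv_words word_inv_inv)

lemma inv_presented_group:
  assumes "u \<in> words X"
  shows "inv\<^bsub>presented_group X R\<^esub> word_class X R u = word_class X R (word_inv u)"
proof -
  interpret group "presented_group X R" by (rule presented_group_is_group)
  have "word_class X R (word_inv u @ u) = word_class X R []"
    using assms word_inv_left[of u X R] word_inv_words[of u X] by (simp add: word_class_eq_iff)
  then show ?thesis
    using assms word_inv_words[of u X]
    by (intro inv_equality)
      (auto simp: mult_presented_group one_presented_group carrier_presented_group)
qed


section \<open>The lower central series acts with high degree\<close>

text \<open>Dual form of saying that the Magnus expansion of \<open>u\<close> is 1 plus terms of
  degree at least \<open>k\<close>: multiplying by such terms lowers the support bound of a
  functional by \<open>k\<close>.\<close>

definition raises_degree :: "nat \<Rightarrow> nat \<Rightarrow> surface_letter word \<Rightarrow> bool" where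
  "raises_degree g k u \<longleftrightarrow> (\<forall>n. \<forall>f\<in>bounded_traces g n.
     (\<lambda>t. acts (crossing_word u) f t - f t) \<in> bounded_traces g (n - int k))"

lemma raises_degree_1: "raises_degree g 1 u"
  by (simp add: raises_degree_def acts_bounded_traces)

text \<open>u v - 1 = (u - 1) v + (v - 1).\<close>

lemma raises_degree_append:
  assumes "raises_degree g k u" "raises_degree g k v"
  shows "raises_degree g k (u @ v)"
  unfolding raises_degree_def
proof (intro allI ballI)
  fix n f assume f: "f \<in> bounded_traces g n"
  let ?h = "acts (crossing_word v) f"
  have "?h \<in> bounded_traces g n" using acts_bounded_traces[OF f] by blast
  then have "(\<lambda>t. acts (crossing_word u) ?h t - ?h t) \<in> bounded_traces g (n - int k)"
    using assms(1) by (simp add: raises_degree_def)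
  moreover have "(\<lambda>t. ?h t - f t) \<in> bounded_traces g (n - int k)"
    using assms(2) f by (simp add: raises_degree_def)
  ultimately show "(\<lambda>t. acts (crossing_word (u @ v)) f t - f t) \<in> bounded_traces g (n - int k)"
    by (auto dest: bounded_traces_add)
qed

lemma acts_word_inv:
  assumes "u \<in> words (surface_letters g)" "f \<in> trace_functions g"
  shows "acts (crossing_word u) (acts (crossing_word (word_inv u)) f) = f"
  using acts_pres_eq[OF word_inv_right[OF assms(1)] assms(2)] by simp

lemma raises_degree_word_inv:
  assumes "u \<in> words (surface_letters g)" "raises_degree g k u"
  shows "raises_degree g k (word_inv u)"
  unfolding raises_degree_def
proof (intro allI ballI)
  fix n f assume f: "f \<in> bounded_traces g n"
  let ?h = "acts (crossing_word (word_inv u)) f"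
  have "?h \<in> bounded_traces g n" using acts_bounded_traces[OF f] by blast
  then have 1: "(\<lambda>t. acts (crossing_word u) ?h t - ?h t) \<in> bounded_traces g (n - int k)"
    using assms(2) by (simp add: raises_degree_def)
  have "acts (crossing_word u) ?h = f"
    using f assms(1) by (intro acts_word_inv) (auto simp: bounded_traces_def)
  \<comment> \<open>With D = f - h the function just bounded, (D - D) - D = h - f is the one
    wanted.\<close>
  with bounded_traces_diff[OF bounded_traces_diff[OF 1 1] 1]
  show "(\<lambda>t. ?h t - f t) \<in> bounded_traces g (n - int k)" by simp
qed

text \<open>\<open>[u, v] - 1 = ((u - 1) (v - 1) - (v - 1) (u - 1)) u\<^sup>-\<^sup>1 v\<^sup>-\<^sup>1\<close> in the group ring.\<close>

lemma raises_degree_commutator: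
  assumes u: "u \<in> words (surface_letters g)" "raises_degree g k u"
    and v: "v \<in> words (surface_letters g)"
  shows "raises_degree g (Suc k) (u @ v @ word_inv u @ word_inv v)"
  unfolding raises_degree_def
proof (intro allI ballI)
  fix n f assume f: "f \<in> bounded_traces g n"
  let ?U = "acts (crossing_word u)" and ?V = "acts (crossing_word v)"
  \<comment> \<open>\<open>h\<close> is the common factor u^-1 v^-1 applied to \<open>f\<close>;
    since v u cancels it, the subtracted term of the identity is \<open>f\<close> itself.\<close>
  define h where "h = acts (crossing_word (word_inv u)) (acts (crossing_word (word_inv v)) f)"
  define p where "p = (\<lambda>t. ?V h t - h t)"
  define q where "q = (\<lambda>t. ?U h t - h t)"
  have f': "f \<in> trace_functions g" using f by (simp add: bounded_traces_def)
  have h: "h \<in> bounded_traces g n"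
    unfolding h_def using f acts_bounded_traces by blast
  have VU: "?V (?U h) = f"
    using u(1) v f' by (simp add: h_def acts_word_inv)
  have p: "p \<in> bounded_traces g (n - 1)"
    unfolding p_def using acts_bounded_traces[OF h] by blast
  have q: "q \<in> bounded_traces g (n - int k)"
    unfolding q_def using u(2) h by (simp add: raises_degree_def)
  have 1: "(\<lambda>t. ?U p t - p t) \<in> bounded_traces g (n - int (Suc k))"
    using u(2)[unfolded raises_degree_def, rule_format, OF p] by (simp add: algebra_simps)
  have "(\<lambda>t. ?V q t - q t) \<in> bounded_traces g (n - int k - 1)"
    using acts_bounded_traces[OF q] by blast
  then have 2: "(\<lambda>t. ?V q t - q t) \<in> bounded_traces g (n - int (Suc k))"
    by (simp add: algebra_simps)
  have "?V h = (\<lambda>t. h t + p t)" "?U h = (\<lambda>t. h t + q t)"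
    by (simp_all add: p_def q_def)
  then have "(\<lambda>t. ?U (?V h) t - ?V (?U h) t) = (\<lambda>t. (?U p t - p t) - (?V q t - q t))"
    by (simp add: acts_add) (simp add: p_def q_def algebra_simps)
  then have "(\<lambda>t. ?U (?V h) t - f t) \<in> bounded_traces g (n - int (Suc k))"
    using bounded_traces_diff[OF 1 2] by (simp add: VU)
  then show "(\<lambda>t. acts (crossing_word (u @ v @ word_inv u @ word_inv v)) f t - f t)
      \<in> bounded_traces g (n - int (Suc k))"
    by (simp add: h_def)
qed

abbreviation surface_class :: "nat \<Rightarrow> surface_letter word \<Rightarrow> surface_letter word set" where
  "surface_class g u \<equiv> word_class (surface_letters g) {surface_relator g} u"

text \<open>One representing word suffices for each element, as the action depends only on the
  class. Commutators gain one degree, and products and inverses keep it, so it passes to the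
  generated subgroup.\<close>

lemma lower_central_raises_degree:
  assumes "k \<ge> 1" "h \<in> lower_central (surface_group g) k"
  shows "\<exists>u\<in>words (surface_letters g). h = surface_class g u \<and> raises_degree g k u"
  using assms
proof (induction k arbitrary: h rule: nat_induct_at_least)
  case base
  then show ?case
    using raises_degree_1 by (auto simp: surface_group_def carrier_presented_group)
next
  case (Suc k)
  let ?G = "surface_group g" and ?W = "words (surface_letters g)"
  let ?C = "{commutator ?G x y | x y. x \<in> lower_central ?G k \<and> y \<in> carrier ?G}"
  have C: "\<exists>u\<in>?W. c = surface_class g u \<and> raises_degree g (Suc k) u" if c: "c \<in> ?C" for c
  proof -
    from c obtain x y where "x \<in> lower_central ?G k" "y \<in> carrier ?G" "c = commutator ?G x y"
      by blast
    then obtain u v where u: "u \<in> ?W" "raises_degree g k u" and v: "v \<in> ?W"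
      and "c = commutator ?G (surface_class g u) (surface_class g v)"
      using Suc.IH[of x] by (auto simp: surface_group_def carrier_presented_group)
    then have "c = surface_class g (u @ v @ word_inv u @ word_inv v)"
      by (simp add: commutator_def surface_group_def inv_presented_group mult_presented_group
          word_inv_words)
    then show ?thesis
      using u v raises_degree_commutator[OF u v] by (auto intro!: bexI simp: word_inv_words)
  qed
  obtain k' where k: "k = Suc k'" using Suc.hyps by (cases k) auto
  have "h \<in> generate ?G ?C"
    using Suc.prems by (simp add: k commutator_subgroup_def)
  then show ?case
  proof induction
    case one
    have "raises_degree g (Suc k) []"
      by (simp add: raises_degree_def bounded_traces_def trace_functions_def)
    then show ?case by (auto simp: surface_group_def one_presented_group intro!: bexI[of _ "[]"])
  next
    case (incl c)
    then show ?case by (rule C)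
  next
    case (inv c)
    then obtain u where "u \<in> ?W" "c = surface_class g u" "raises_degree g (Suc k) u"
      using C by blast
    then show ?case
      by (intro bexI[of _ "word_inv u"])
        (auto simp: surface_group_def inv_presented_group word_inv_words raises_degree_word_inv)
  next
    case (eng x y)
    then obtain u v where "u \<in> ?W" "x = surface_class g u" "raises_degree g (Suc k) u"
      "v \<in> ?W" "y = surface_class g v" "raises_degree g (Suc k) v" by blast
    then show ?case
      by (intro bexI[of _ "u @ v"])
        (auto simp: surface_group_def mult_presented_group intro: raises_degree_append)
  qed
qed

lemma word_length_bound:
  assumes u: "u \<in> words (surface_letters g)" and "k \<ge> 1"
    and "surface_class g u \<in> lower_central (surface_group g) k"
    and nontrivial: "surface_class g u \<noteq> \<one>\<^bsub>surface_group g\<^esub>"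
  shows "k \<le> 4 * length u"
proof -
  let ?G = "surface_group g"
  \<comment> \<open>The value outside the generators is a default: the locale asks for closure at
    every index.\<close>
  define gen where "gen x = (if x \<in> surface_letters g then surface_class g [(x, True)] else \<one>\<^bsub>?G\<^esub>)"
    for x
  interpret group ?G unfolding surface_group_def by (rule presented_group_is_group)
  have class_closed: "surface_class g v \<in> carrier ?G" if "v \<in> words (surface_letters g)" for v
    using that by (simp add: surface_group_def carrier_presented_group)
  interpret surface_tuple ?G g "\<lambda>i. gen (A i)" "\<lambda>i. gen (B i)"
    by unfold_locales (auto simp: gen_def class_closed)
  have mult: "surface_class g v \<otimes>\<^bsub>?G\<^esub> surface_class g w = surface_class g (v @ w)"
    if "v \<in> words (surface_letters g)" "w \<in> words (surface_letters g)" for v w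
    using that by (simp add: surface_group_def mult_presented_group)
  have gen: "gen x = surface_class g [(x, True)]" if "x \<in> surface_letters g" for x
    using that by (simp add: gen_def)
  have one_class: "\<one>\<^bsub>?G\<^esub> = surface_class g []"
    by (simp add: surface_group_def one_presented_group)
  have inv_gen: "inv\<^bsub>?G\<^esub> surface_class g [(x, True)] = surface_class g [(x, False)]"
    if "x \<in> surface_letters g" for x
    using that by (simp add: surface_group_def inv_presented_group word_inv_def)
  have prefix: "surface_relator m \<in> words (surface_letters g) \<and>
      relator_prefix m = surface_class g (surface_relator m)" if "m \<le> g" for m
    using that
  proof (induction m)
    case 0
    then show ?case by (simp add: one_class)
  next
    case (Suc m)
    then have "A (Suc m) \<in> surface_letters g" "B (Suc m) \<in> surface_letters g"
      by (auto simp: surface_letters_def)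
    then show ?case using Suc by (simp add: gen commutator_def inv_gen mult)
  qed
  have "pres_eq (surface_letters g) {surface_relator g} (surface_relator g) []"
    using pres_eq.relator[of "[]" "surface_letters g" "[]" "surface_relator g" "{surface_relator g}"]
      surface_relator_words by simp
  then have relation: "relator_prefix g = \<one>\<^bsub>?G\<^esub>"
    using prefix[of g] surface_relator_words[of g]
    by (simp add: one_class word_class_eq_iff)
  have holonomy: "holonomy (False, False) (crossing_word v) = surface_class g v"
    if "v \<in> words (surface_letters g)" for v
    using that
  proof (induction v)
    case Nil
    then show ?case by (simp add: one_class)
  next
    case (Cons l v)
    obtain x s where l: "l = (x, s)" by (cases l)
    have x: "x \<in> surface_letters g" using Cons.prems by (simp add: l)
    then obtain i where "i \<ge> 1" "x = A i \<or> x = B i"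
      by (auto simp: surface_letters_def)
    then have "holonomy (False, False) (crossings l) = surface_class g [l]"
      using x holonomy_crossings[of i] gen[of x] inv_gen[of x]
      by (cases s) (auto simp: l simp del: crossings.simps)
    moreover have "path_end (False, False) (crossings l) = (False, False)"
      using crossing_word_path[of "[l]" g] x by (simp add: l)
    ultimately show ?case
      using Cons x mult[of "[l]" v] by (simp add: holonomy_append l)
  qed
  \<comment> \<open>Here both invariants are used: the holonomy forces \<open>v\<close> to be
    nonempty, and the action carries the degree estimate for the class of \<open>u\<close> over to
    \<open>v\<close>.\<close>
  obtain v where v: "length v \<le> length (crossing_word u)" "rigid g (map fst v)"
    "holonomy (False, False) v = surface_class g u"
    "\<forall>f\<in>trace_functions g. acts v f = acts (crossing_word u) f"
    using rigid_representative[OF relation conjunct1[OF crossing_word_path[OF u]]]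
    unfolding holonomy[OF u] by blast
  have "v \<noteq> []"
  proof
    assume "v = []"
    then show False using v(3) nontrivial by (simp only: holonomy.simps)
  qed
  let ?f = "trace_indicator g (map fst v)"
  have f: "?f \<in> bounded_traces g (int (length v))"
    using trace_indicator_bounded[OF v(2)] by simp
  obtain u' where u': "u' \<in> words (surface_letters g)" "surface_class g u = surface_class g u'"
    "raises_degree g k u'"
    using lower_central_raises_degree[OF assms(2,3)] by blast
  have f': "?f \<in> trace_functions g" using f by (simp add: bounded_traces_def)
  have "pres_eq (surface_letters g) {surface_relator g} u u'"
    using u'(2) word_class_eq_iff[OF u] by blast
  then have "acts (crossing_word u') ?f = acts v ?f"
    using acts_pres_eq[OF _ f'] v(4) f' by simp
  then have "(\<lambda>t. acts v ?f t - ?f t) \<in> bounded_traces g (int (length v) - int k)"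
    using u'(3)[unfolded raises_degree_def, rule_format, OF f] by simp
  moreover have "acts v ?f [] - ?f [] \<noteq> 0"
    using rigid_detected[OF v(2) \<open>v \<noteq> []\<close>] by simp
  \<comment> \<open>The empty word has length 0, so a nonzero value there rules out a negative
    bound.\<close>
  ultimately have "\<not> int (length v) - int k < int (length ([] :: curve list))"
    unfolding bounded_traces_def by blast
  then show ?thesis using v(1) length_crossing_word[of u] by simp
qed

section \<open>Word norm and lengths of signed words\<close>

lemma surface_gens_word:
  assumes "set xs \<subseteq> surface_gens g \<union> m_inv (surface_group g) ` surface_gens g"
  shows "\<exists>u\<in>words (surface_letters g). length u = length xs \<and>
    foldr (\<otimes>\<^bsub>surface_group g\<^esub>) xs \<one>\<^bsub>surface_group g\<^esub> = surface_class g u"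
  using assms
proof (induction xs)
  case Nil
  show ?case by (rule bexI[of _ "[]"]) (simp_all add: surface_group_def one_presented_group)
next
  case (Cons y xs)
  then obtain u where u: "u \<in> words (surface_letters g)" "length u = length xs"
    "foldr (\<otimes>\<^bsub>surface_group g\<^esub>) xs \<one>\<^bsub>surface_group g\<^esub> = surface_class g u"
    by auto
  have "y \<in> surface_gens g \<or> y \<in> m_inv (surface_group g) ` surface_gens g"
    using Cons.prems by auto
  then obtain x s where x: "x \<in> surface_letters g" "y = surface_class g [(x, s)]"
    by (auto simp: surface_gens_def surface_group_def inv_presented_group word_inv_def)
  have "y \<otimes>\<^bsub>surface_group g\<^esub> surface_class g u = surface_class g ((x, s) # u)"
    using x u mult_presented_group[of "[(x, s)]" "surface_letters g" u "{surface_relator g}"]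
    by (simp add: surface_group_def)
  then show ?case using x u by (intro bexI[of _ "(x, s) # u"]) simp_all
qed

lemma surface_class_word:
  assumes "u \<in> words (surface_letters g)"
  shows "\<exists>xs. set xs \<subseteq> surface_gens g \<union> m_inv (surface_group g) ` surface_gens g \<and>
    foldr (\<otimes>\<^bsub>surface_group g\<^esub>) xs \<one>\<^bsub>surface_group g\<^esub> = surface_class g u"
  using assms
proof (induction u)
  case Nil
  show ?case by (rule exI[of _ "[]"]) (simp add: surface_group_def one_presented_group)
next
  case (Cons l u)
  obtain x s where l: "l = (x, s)" by (cases l)
  have x: "x \<in> surface_letters g" using Cons.prems by (simp add: l)
  have gen: "surface_class g [(x, True)] \<in> surface_gens g"
    using x by (simp add: surface_gens_def)
  moreover have "surface_class g [(x, False)] =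
      inv\<^bsub>surface_group g\<^esub> surface_class g [(x, True)]"
    using x by (simp add: surface_group_def inv_presented_group word_inv_def)
  ultimately have "surface_class g [l] \<in> surface_gens g \<union> m_inv (surface_group g) ` surface_gens g"
    by (cases s) (auto simp: l)
  moreover obtain xs where "set xs \<subseteq> surface_gens g \<union> m_inv (surface_group g) ` surface_gens g"
    "foldr (\<otimes>\<^bsub>surface_group g\<^esub>) xs \<one>\<^bsub>surface_group g\<^esub> = surface_class g u"
    using Cons by auto
  moreover have "surface_class g [l] \<otimes>\<^bsub>surface_group g\<^esub> surface_class g u = surface_class g (l # u)"
    using x Cons.prems mult_presented_group[of "[l]" "surface_letters g" u "{surface_relator g}"]
    by (simp add: surface_group_def l)
  ultimately show ?case by (intro exI[of _ "surface_class g [l] # xs"]) simp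
qed

lemma lower_central_subset_carrier: "group G \<Longrightarrow> lower_central G k \<subseteq> carrier G"
proof (induction G k rule: lower_central.induct)
  case (3 G k)
  interpret group G by fact
  have "{commutator G x y |x y. x \<in> lower_central G (Suc k) \<and> y \<in> carrier G} \<subseteq> carrier G"
    using 3 by (auto simp: commutator_def)
  then show ?case
    by (simp add: commutator_subgroup_def generate_incl)
qed auto

lemma word_norm_bound:
  assumes "k \<ge> 1" "w \<in> lower_central (surface_group g) k" "w \<noteq> \<one>\<^bsub>surface_group g\<^esub>"
  shows "k \<le> 4 * word_norm (surface_group g) (surface_gens g) w"
proof -
  let ?L = "{length xs | xs. set xs \<subseteq> surface_gens g \<union> m_inv (surface_group g) ` surface_gens g \<and>
    foldr (\<otimes>\<^bsub>surface_group g\<^esub>) xs \<one>\<^bsub>surface_group g\<^esub> = w}"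
  have "w \<in> carrier (surface_group g)"
    using assms(2) lower_central_subset_carrier[of "surface_group g" k]
    by (auto simp: surface_group_def presented_group_is_group)
  then obtain u where u: "u \<in> words (surface_letters g)" "w = surface_class g u"
    by (auto simp: surface_group_def carrier_presented_group)
  obtain ys where "set ys \<subseteq> surface_gens g \<union> m_inv (surface_group g) ` surface_gens g"
    "foldr (\<otimes>\<^bsub>surface_group g\<^esub>) ys \<one>\<^bsub>surface_group g\<^esub> = w"
    using surface_class_word[OF u(1)] unfolding u(2)[symmetric] by (elim exE conjE)
  then have "length ys \<in> ?L"
    by (intro CollectI exI[of _ ys] conjI HOL.refl)
  then have "?L \<noteq> {}" by (rule ex_in_conv[THEN iffD1, OF exI])
  then have "word_norm (surface_group g) (surface_gens g) w \<in> ?L"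
    unfolding word_norm_def by (rule Inf_nat_def1)
  then obtain xs where xs: "set xs \<subseteq> surface_gens g \<union> m_inv (surface_group g) ` surface_gens g"
    "foldr (\<otimes>\<^bsub>surface_group g\<^esub>) xs \<one>\<^bsub>surface_group g\<^esub> = w"
    "length xs = word_norm (surface_group g) (surface_gens g) w"
    by (elim CollectE exE conjE) simp
  then obtain v where "v \<in> words (surface_letters g)" "length v = length xs" "w = surface_class g v"
    using surface_gens_word[OF xs(1)] by blast
  then show ?thesis using word_length_bound[of v g k] assms xs(3) by simp
qed


section \<open>Non-nilpotency\<close>

text \<open>\<open>(e, n)\<close> stands for the map \<open>x \<mapsto> e * x + n\<close>.\<close>

definition infinite_dihedral :: "(int \<times> int) monoid" where
  "infinite_dihedral =
     \<lparr>carrier = {1, -1} \<times> UNIV, mult = (\<lambda>(e, n) (e', n'). (e * e', n + e * n')), one = (1, 0)\<rparr>"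

lemma infinite_dihedral_simps [simp]:
  "carrier infinite_dihedral = {1, -1} \<times> UNIV"
  "(e, n) \<otimes>\<^bsub>infinite_dihedral\<^esub> (e', n') = (e * e', n + e * n')"
  "\<one>\<^bsub>infinite_dihedral\<^esub> = (1, 0)"
  by (simp_all add: infinite_dihedral_def)

lemma group_infinite_dihedral: "group infinite_dihedral"
proof (rule groupI)
  fix x assume "x \<in> carrier infinite_dihedral"
  then obtain e n where x: "x = (e, n)" "e = 1 \<or> e = -1" by auto
  then show "\<exists>y\<in>carrier infinite_dihedral. y \<otimes>\<^bsub>infinite_dihedral\<^esub> x = \<one>\<^bsub>infinite_dihedral\<^esub>"
    by (intro bexI[of _ "(e, - e * n)"]) auto
qed (auto simp: algebra_simps)

lemma inv_infinite_dihedral: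
  "e = 1 \<or> e = -1 \<Longrightarrow> inv\<^bsub>infinite_dihedral\<^esub> (e, n) = (e, - e * n)"
  by (intro group.inv_equality[OF group_infinite_dihedral]) auto

lemma surface_group_to_infinite_dihedral:
  assumes "g \<ge> 2"
  shows "\<exists>\<phi>\<in>hom (surface_group g) infinite_dihedral.
    \<phi> (surface_class g [(A 1, True)]) = (1, 1) \<and> \<phi> (surface_class g [(A 2, True)]) = (-1, 0)"
proof -
  define f :: "surface_letter \<Rightarrow> int \<times> int"
    \<comment> \<open>\<open>A 1\<close> becomes a unit translation and \<open>A 2\<close> a
      reflection. Every \<open>B i\<close> becomes trivial, so each commutator in the relator does
      too.\<close>
    where "f x = (if x = A 1 then (1, 1) else if x = A 2 then (-1, 0) else (1, 0))" for x
  have f: "f x \<in> carrier infinite_dihedral" for x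
    by (auto simp: f_def)
  note eval_append = word_eval_append[where f = f and X = UNIV, OF group_infinite_dihedral f]
  have all: "u \<in> words UNIV" for u :: "surface_letter word" by (simp add: words_def)
  have "word_eval infinite_dihedral f (surface_relator m) = \<one>\<^bsub>infinite_dihedral\<^esub>" for m
  proof (induction m)
    case 0
    then show ?case by (simp add: word_eval_def)
  next
    case (Suc m)
    have "word_eval infinite_dihedral f
      [(A (Suc m), True), (B (Suc m), True), (A (Suc m), False), (B (Suc m), False)] = (1, 0)"
      by (simp add: word_eval_def f_def inv_infinite_dihedral)
    then show ?case using Suc by (simp only: surface_relator_simps eval_append[OF all all]) simp
  qed
  then obtain \<phi> where "\<phi> \<in> hom (surface_group g) infinite_dihedral"
      "\<forall>x\<in>surface_letters g. \<phi> (surface_class g [(x, True)]) = f x"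
    unfolding surface_group_def
    using presented_group_universal[where f = f and X = "surface_letters g" and
        R = "{surface_relator g}", OF group_infinite_dihedral f]
    by auto
  moreover have "A 1 \<in> surface_letters g" "A 2 \<in> surface_letters g"
    using assms by (auto simp: surface_letters_def)
  moreover have "f (A 1) = (1, 1)" "f (A 2) = (-1, 0)"
    by (simp_all add: f_def)
  ultimately show ?thesis by (intro bexI[of _ \<phi>]) (simp_all only: simp_thms)
qed

text \<open>The commutator of translation by n with the reflection is translation by 2 n, so
  iterated commutators of \<open>A 1\<close> with \<open>A 2\<close> never die.\<close>

lemma lower_central_nontrivial:
  assumes "g \<ge> 2"
  shows "\<exists>w\<in>lower_central (surface_group g) k. w \<noteq> \<one>\<^bsub>surface_group g\<^esub>"
proof -
  let ?G = "surface_group g"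
  interpret G: group ?G unfolding surface_group_def by (rule presented_group_is_group)
  interpret D: group infinite_dihedral by (rule group_infinite_dihedral)
  obtain \<phi> where \<phi>: "\<phi> \<in> hom ?G infinite_dihedral" "\<phi> (surface_class g [(A 1, True)]) = (1, 1)"
    "\<phi> (surface_class g [(A 2, True)]) = (-1, 0)"
    using surface_group_to_infinite_dihedral[OF assms] by (elim bexE conjE)
  interpret \<phi>: group_hom ?G infinite_dihedral \<phi>
    by unfold_locales (rule \<phi>(1))
  have gens: "surface_class g [(A 1, True)] \<in> carrier ?G" "surface_class g [(A 2, True)] \<in> carrier ?G"
    using assms by (auto simp: surface_group_def carrier_presented_group surface_letters_def)
  have ex: "\<exists>w\<in>lower_central ?G (Suc m). \<phi> w = (1, 2 ^ m)" for m
  proof (induction m)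
    case 0
    then show ?case using \<phi>(2) gens by auto
  next
    case (Suc m)
    then obtain w where w: "w \<in> lower_central ?G (Suc m)" "\<phi> w = (1, 2 ^ m)" by blast
    let ?s = "surface_class g [(A 2, True)]"
    have "commutator ?G w ?s \<in> lower_central ?G (Suc (Suc m))"
      unfolding lower_central.simps commutator_subgroup_def
      by (rule generate.incl) (use w gens in blast)
    moreover have "w \<in> carrier ?G"
      using w lower_central_subset_carrier[OF G.is_group] by blast
    then have "\<phi> (commutator ?G w ?s) = (1, 2 ^ Suc m)"
      using gens w(2) \<phi>(3) by (simp add: commutator_def inv_infinite_dihedral)
    ultimately show ?case by blast
  qed
  have nontrivial: "w \<noteq> \<one>\<^bsub>?G\<^esub>" if "\<phi> w = (1, 2 ^ m)" for w m
    using that \<phi>.hom_one by auto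
  show ?thesis
  proof (cases k)
    case 0
    \<comment> \<open>The dummy term at index 0 equals the first term, so the same witness
      serves.\<close>
    then show ?thesis using ex[of 0] nontrivial[of _ 0] by (metis lower_central.simps(1,2))
  next
    case (Suc m)
    then show ?thesis using ex[of m] nontrivial by blast
  qed
qed

theorem theorem1:
  fixes g :: nat
  assumes "g \<ge> 2"
  shows "\<forall>k::nat. k \<ge> 1 \<longrightarrow>
    real (lcs_depth (surface_group g) (surface_gens g) k) \<ge> 1 / 4 * real k \<and>
    (\<forall>w \<in> lower_central (surface_group g) k. w \<noteq> \<one>\<^bsub>surface_group g\<^esub> \<longrightarrow>
      real (word_norm (surface_group g) (surface_gens g) w) \<ge> 1 / 4 * real k)"
proof (intro allI impI conjI ballI)
  fix k :: nat and w
  assume "k \<ge> 1" "w \<in> lower_central (surface_group g) k" "w \<noteq> \<one>\<^bsub>surface_group g\<^esub>"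
  then show "real (word_norm (surface_group g) (surface_gens g) w) \<ge> 1 / 4 * real k"
    using word_norm_bound[of k w g] by simp
next
  fix k :: nat assume k: "k \<ge> 1"
  let ?N = "{word_norm (surface_group g) (surface_gens g) h | h.
    h \<in> lower_central (surface_group g) k \<and> h \<noteq> \<one>\<^bsub>surface_group g\<^esub>}"
  \<comment> \<open>Nontriviality makes the infimum an attained minimum; over the empty set it would
    be 0 and the bound would fail.\<close>
  have "?N \<noteq> {}" using lower_central_nontrivial[OF assms, of k] by blast
  then have "lcs_depth (surface_group g) (surface_gens g) k \<in> ?N"
    unfolding lcs_depth_def by (rule Inf_nat_def1)
  then obtain h where "h \<in> lower_central (surface_group g) k" "h \<noteq> \<one>\<^bsub>surface_group g\<^esub>"
    "lcs_depth (surface_group g) (surface_gens g) k = word_norm (surface_group g) (surface_gens g) h"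
    by auto
  then show "real (lcs_depth (surface_group g) (surface_gens g) k) \<ge> 1 / 4 * real k"
    using word_norm_bound[OF k, of h g] by simp
qed

end
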